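(* Let $G$ be an Abelian group and $G\neq\mathbb{Z}_2,\mathbb{Z}_3,\mathbb{Z}_5$. If $G$ has the finite acyclic matching property, then it fails to have the acyclic matching property at order $m$, for some $m\in\mathbb{N}\cup\{\infty\}$.
   Context: Groups are written additively; $\mathbb{N}$ is the set of positive integers; $\mathbb{Z}_n$ is the cyclic group of order $n$; $\#X$ denotes the number of elements of $X$, with $\#X=\infty$ if $X$ is infinite. Let $A,B$ be non-empty subsets of an Abelian group $G$. A matching from $A$ to $B$ is a bijection $f:A\to B$ such that $a+f(a)\notin A$ for all $a\in A$. For a matching $f:A\to B$, define $m_f:G\to\mathbb{Z}\cup\{\infty\}$ by $m_f(x)=\#\{a\in A: a+f(a)=x\}$. A matching $f:A\to B$ is called acyclic if for every matching $g:A\to B$ with $m_f=m_g$ one has $f=g$. The group $G$ has the finite acyclic matching property if for every pair $A,B$ of non-empty finite subsets of $G$ with $\#A=\#B$ and $0\notin B$ there exists at least one acyclic matching from $A$ to $B$. For $m\in\mathbb{N}\cup\{\infty\}$, $G$ fails to have the acyclic matching property at order $m$ if there exist subsets $A,B$ of $G$ and matchings $f,g:A\to B$ such that $\#A=\#B=m$, $f\neq g$ and $m_f=m_g$.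
   Formalization: The group G is additionally assumed non-trivial: for G = {0} the finite acyclic matching property holds vacuously, but there is no matching between non-empty subsets, so the claim as stated fails for that one group. *)

theory Defs
  imports "HOL-Algebra.Elementary_Groups" "HOL-Library.Extended_Nat"
begin

text \<open>
  HOL-Algebra groups are multiplicative: \<open>a \<otimes>\<^bsub>G\<^esub> b\<close> stands for \<open>a + b\<close> and \<open>\<one>\<^bsub>G\<^esub>\<close> for \<open>0\<close>.
\<close>

definition num_elems :: "'a set \<Rightarrow> enat" where
  "num_elems X = (if finite X then enat (card X) else \<infinity>)"

text \<open>
  A map \<open>A \<rightarrow> B\<close> is represented by a total function of which only the values on \<open>A\<close> matter;
  accordingly, equality of two matchings is equality on \<open>A\<close>.
\<close>

definition matching :: "('a, 'b) monoid_scheme \<Rightarrow> 'a set \<Rightarrow> 'a set \<Rightarrow> ('a \<Rightarrow> 'a) \<Rightarrow> bool" where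
  "matching G A B f \<longleftrightarrow>
     A \<subseteq> carrier G \<and> B \<subseteq> carrier G \<and> A \<noteq> {} \<and> B \<noteq> {} \<and>
     bij_betw f A B \<and> (\<forall>a\<in>A. a \<otimes>\<^bsub>G\<^esub> f a \<notin> A)"

definition multiplicity_fun :: "('a, 'b) monoid_scheme \<Rightarrow> 'a set \<Rightarrow> ('a \<Rightarrow> 'a) \<Rightarrow> 'a \<Rightarrow> enat" where
  "multiplicity_fun G A f x = num_elems {a \<in> A. a \<otimes>\<^bsub>G\<^esub> f a = x}"

definition acyclic_matching :: "('a, 'b) monoid_scheme \<Rightarrow> 'a set \<Rightarrow> 'a set \<Rightarrow> ('a \<Rightarrow> 'a) \<Rightarrow> bool" where
  "acyclic_matching G A B f \<longleftrightarrow>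
     matching G A B f \<and>
     (\<forall>g. matching G A B g \<and>
          (\<forall>x\<in>carrier G. multiplicity_fun G A f x = multiplicity_fun G A g x) \<longrightarrow>
          (\<forall>a\<in>A. f a = g a))"

definition finite_acyclic_matching_property :: "('a, 'b) monoid_scheme \<Rightarrow> bool" where
  "finite_acyclic_matching_property G \<longleftrightarrow>
     (\<forall>A B. A \<subseteq> carrier G \<and> B \<subseteq> carrier G \<and> A \<noteq> {} \<and> B \<noteq> {} \<and> finite A \<and> finite B \<and>
            card A = card B \<and> \<one>\<^bsub>G\<^esub> \<notin> B \<longrightarrow>
            (\<exists>f. acyclic_matching G A B f))"

definition fails_acyclic_matching_at_order :: "('a, 'b) monoid_scheme \<Rightarrow> enat \<Rightarrow> bool" where
  "fails_acyclic_matching_at_order G m \<longleftrightarrow>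
     (\<exists>A B f g. A \<subseteq> carrier G \<and> B \<subseteq> carrier G \<and>
        matching G A B f \<and> matching G A B g \<and> num_elems A = m \<and> num_elems B = m \<and>
        (\<exists>a\<in>A. f a \<noteq> g a) \<and>
        (\<forall>x\<in>carrier G. multiplicity_fun G A f x = multiplicity_fun G A g x))"

end

(* A finite nontrivial proper subgroup H is an obstruction to matchability: since H + H = H, a
   matching from H to (H - {0}) \<union> {x} with x outside H cannot send any element of H into H, but
   H - {0} has to be hit. Hence under the finite acyclic matching property every element of small
   finite order n generates G, and n is prime. Excluding the cyclic groups of orders 2, 3 and 5, G
   contains an element x of infinite order or of order at least 6. Then the two distinct matchings
   (0, x, 2x) \<mapsto> (3x, 4x, 2x) and (0, x, 2x) \<mapsto> (4x, 2x, 3x) from {0, x, 2x} to {2x, 3x, 4x}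
   both have the sums 3x, 4x, 5x, each attained once. *)

theory Submission
  imports Defs "HOL-Algebra.Multiplicative_Group"
begin

text \<open>Equal powers force \<open>ord x\<close> to divide the difference of the exponents, whose
  absolute value is below \<open>k\<close>, so it is zero. The value \<open>ord x = 0\<close>
  encodes infinite order, and 0 divides only 0.\<close>

lemma (in group) nat_pow_eq_iff_lessThan:
  assumes "x \<in> carrier G" "ord x = 0 \<or> k \<le> ord x" "m < k" "n < k"
  shows "x [^] (m::nat) = x [^] (n::nat) \<longleftrightarrow> m = n"
proof -
  have "x [^] m = x [^] n \<longleftrightarrow> int (ord x) dvd int n - int m"
    using int_pow_eq[OF assms(1), of "int m" "int n"] by (simp add: int_pow_int)
  moreover have "int n - int m = 0" if "int (ord x) dvd int n - int m"
    using assms(2)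
  proof
    assume "k \<le> ord x"
    with assms(3,4) that show ?thesis
      using dvd_imp_le_int[of "int n - int m" "int (ord x)"] by linarith
  qed (use that in simp)
  ultimately show ?thesis by auto
qed

text \<open>The bound 6 is what keeps \<open>e 0\<close>, ..., \<open>e 5\<close> distinct; all
  elements of \<open>A\<close> and \<open>B\<close> and all sums that occur are among these.\<close>

lemma (in group) fails_acyclic_matching_at_order_3:
  assumes x: "x \<in> carrier G" and ord: "ord x = 0 \<or> 6 \<le> ord x"
  shows "fails_acyclic_matching_at_order G 3"
proof -
  define e where "e = (\<lambda>n::nat. x [^] n)"
  have e_carrier: "e n \<in> carrier G" for n
    using x by (simp add: e_def)
  have e_mult: "e m \<otimes> e n = e (m + n)" for m n
    using x by (simp add: e_def nat_pow_mult)
  have e_eq: "e m = e n \<longleftrightarrow> m = n" if "m < 6" "n < 6" for m n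
    unfolding e_def using nat_pow_eq_iff_lessThan[OF x ord that] .
  define A B where "A = {e 0, e 1, e 2}" and "B = {e 2, e 3, e 4}"
  define f where "f = (\<lambda>a. if a = e 0 then e 3 else if a = e 1 then e 4 else e 2)"
  define g where "g = (\<lambda>a. if a = e 0 then e 4 else if a = e 1 then e 2 else e 3)"
  have f: "f (e 0) = e 3" "f (e 1) = e 4" "f (e 2) = e 2"
    and g: "g (e 0) = e 4" "g (e 1) = e 2" "g (e 2) = e 3"
    by (simp_all add: f_def g_def e_eq)
  have card: "num_elems A = 3" "num_elems B = 3"
    by (simp_all add: A_def B_def num_elems_def e_eq numeral_eq_enat)
  have "matching G A B f" "matching G A B g"
    unfolding matching_def bij_betw_def inj_on_def
    by (auto simp: A_def B_def f g e_carrier e_mult e_eq simp del: One_nat_def)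
  moreover have "multiplicity_fun G A f y = multiplicity_fun G A g y" for y
  proof -
    \<comment> \<open>With each fibre split into its three possible points, only the sums
      \<open>e 3\<close>, \<open>e 4\<close>, \<open>e 5\<close> remain to be compared with
      \<open>y\<close>.\<close>
    have sums: "{a \<in> A. a \<otimes> h a = y} = 
        (if e 0 \<otimes> h (e 0) = y then {e 0} else {}) \<union> (if e 1 \<otimes> h (e 1) = y then {e 1} else {}) \<union>
        (if e 2 \<otimes> h (e 2) = y then {e 2} else {})" for h
      by (auto simp: A_def)
    show ?thesis
      unfolding multiplicity_fun_def sums f g e_mult
      by (cases "y = e 3"; cases "y = e 4"; cases "y = e 5") (simp_all add: e_eq num_elems_def del: One_nat_def)
  qed
  moreover have "e 0 \<in> A" "f (e 0) \<noteq> g (e 0)"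
    by (simp_all add: A_def f g e_eq)
  moreover have "A \<subseteq> carrier G" "B \<subseteq> carrier G"
    by (auto simp: A_def B_def e_carrier)
  ultimately show ?thesis
    using card unfolding fails_acyclic_matching_at_order_def by blast
qed

lemma (in group) finite_subgroup_trivial_or_whole:
  assumes "finite_acyclic_matching_property G" and H: "subgroup H G" "finite H" "H \<noteq> {\<one>}"
  shows "H = carrier G"
proof (rule ccontr)
  assume "H \<noteq> carrier G"
  then obtain x where x: "x \<in> carrier G" "x \<notin> H"
    using subgroup.subset[OF H(1)] by blast
  have one: "\<one> \<in> H"
    using subgroup.one_closed[OF H(1)] .
  \<comment> \<open>Trading the identity for a point outside \<open>H\<close> keeps the cardinality
    and removes the identity, as the matching property requires.\<close>
  define B where "B = insert x (H - {\<one>})"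
  have "H \<subseteq> carrier G" "B \<subseteq> carrier G" "H \<noteq> {}" "B \<noteq> {}" "finite B" "\<one> \<notin> B"
    using subgroup.subset[OF H(1)] x one H(2) by (auto simp: B_def)
  moreover have "card H = card B"
    using x(2) H(2) card.remove[OF H(2) one] by (simp add: B_def)
  ultimately obtain f where "acyclic_matching G H B f"
    using assms(1) H(2) unfolding finite_acyclic_matching_property_def by blast
  then have f: "f ` H = B" "\<forall>a\<in>H. a \<otimes> f a \<notin> H"
    by (auto simp: acyclic_matching_def matching_def bij_betw_def)
  obtain b where "b \<in> H" "b \<noteq> \<one>"
    using one H(3) by blast
  then have "b \<in> f ` H"
    unfolding f(1) B_def by blast
  then obtain a where a: "a \<in> H" "f a = b"
    by blast
  show False
    using f(2) subgroup.m_closed[OF H(1) a(1) \<open>b \<in> H\<close>] a by blast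
qed

text \<open>The isomorphism is the exponent map from integers modulo \<open>ord x\<close> to powers
  of \<open>x\<close>. Infinite order is included, since \<open>integer_mod_group 0\<close> is the
  group of integers.\<close>

lemma (in group) generate_ord_iso_integer_mod_group:
  assumes x: "x \<in> carrier G" and gen: "generate G {x} = carrier G"
  shows "G \<cong> integer_mod_group (ord x)"
proof -
  let ?Z = "integer_mod_group (ord x)"
  \<comment> \<open>Addition in \<open>?Z\<close> is reduced modulo \<open>ord x\<close>; powers of
    \<open>x\<close> do not see this reduction.\<close>
  have mod: "x [^] (k mod int (ord x)) = x [^] k" for k :: int
    using x by (simp add: int_pow_eq minus_mod_eq_mult_div)
  have "(\<lambda>k::int. x [^] k) \<in> hom ?Z G"
    using x by (auto simp: hom_def mod int_pow_mult)
  moreover have "inj_on (\<lambda>k::int. x [^] k) (carrier ?Z)"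
  proof (rule inj_onI)
    fix i j assume ij: "i \<in> carrier ?Z" "j \<in> carrier ?Z" "x [^] i = x [^] j"
    then have "int (ord x) dvd j - i"
      using int_pow_eq[OF x] by blast
    then have "j mod int (ord x) = i mod int (ord x)"
      by (simp add: mod_eq_dvd_iff)
    with ij(1,2) show "i = j"
      by (auto simp: carrier_integer_mod_group split: if_splits)
  qed
  moreover have "(\<lambda>k::int. x [^] k) ` carrier ?Z = carrier G"
  proof -
    have "x [^] k \<in> (\<lambda>k::int. x [^] k) ` carrier ?Z" for k :: int
      by (rule image_eqI[of _ _ "k mod int (ord x)"])
        (auto simp: mod carrier_integer_mod_group)
    moreover have "carrier G = range (\<lambda>k::int. x [^] k)"
      using gen generate_pow[OF x] by (simp add: full_SetCompr_eq)
    ultimately show ?thesis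
      using x by auto
  qed
  ultimately have "(\<lambda>k::int. x [^] k) \<in> iso ?Z G"
    by (simp add: iso_def bij_betw_def)
  then show ?thesis
    using group.iso_sym[OF group_integer_mod_group] by (auto simp: is_iso_def)
qed

theorem theorem1p3:
  fixes G :: "('a, 'b) monoid_scheme"
  assumes "comm_group G"
    and "carrier G \<noteq> {\<one>\<^bsub>G\<^esub>}"
    and "\<not> G \<cong> integer_mod_group 2"
    and "\<not> G \<cong> integer_mod_group 3"
    and "\<not> G \<cong> integer_mod_group 5"
    and "finite_acyclic_matching_property G"
  shows "\<exists>m::enat. m \<ge> 1 \<and> fails_acyclic_matching_at_order G m"
proof -
  interpret comm_group G by fact
  have gen: "generate G {y} = carrier G"
    if y: "y \<in> carrier G" "y \<noteq> \<one>\<^bsub>G\<^esub>" "ord y \<noteq> 0" for y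
  proof (rule finite_subgroup_trivial_or_whole[OF assms(6)])
    show "subgroup (generate G {y}) G"
      using y by (simp add: generate_is_subgroup)
    \<comment> \<open>The cardinality is \<open>ord y\<close>, which is nonzero, whereas
      \<open>card\<close> of an infinite set is 0.\<close>
    show "finite (generate G {y})"
      using y generate_pow_card[of y] by (metis card.infinite)
    show "generate G {y} \<noteq> {\<one>\<^bsub>G\<^esub>}"
      using y generate.incl[of y "{y}" G] by auto
  qed
  obtain x where x: "x \<in> carrier G" "x \<noteq> \<one>\<^bsub>G\<^esub>"
    using assms(2) one_closed by blast
  have "ord x = 0 \<or> 6 \<le> ord x"
  proof (rule ccontr)
    assume small: "\<not> (ord x = 0 \<or> 6 \<le> ord x)"
    then have "G \<cong> integer_mod_group (ord x)"
      using x gen generate_ord_iso_integer_mod_group by blast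
    then have "ord x \<noteq> 2" "ord x \<noteq> 3" "ord x \<noteq> 5"
      using assms(3-5) by auto
    moreover have "ord x \<noteq> 1"
      using x ord_eq_1 by blast
    ultimately have 4: "ord x = 4"
      using small by linarith
    \<comment> \<open>Order 4 is the remaining case: the square of \<open>x\<close> has order 2, so
      it would have to generate all of \<open>G\<close> with only two elements, while
      \<open>x\<close> generates four.\<close>
    let ?y = "x [^]\<^bsub>G\<^esub> (2::nat)"
    have y: "?y \<in> carrier G" "ord ?y = 2"
      using x 4 ord_pow[of x 2] by auto
    then have "generate G {?y} = generate G {x}"
      using gen[of ?y] gen[of x] x 4 ord_eq_1[of ?y] by simp
    then show False
      using generate_pow_card[of x] generate_pow_card[of ?y] x y 4 by simp
  qed
  then have "fails_acyclic_matching_at_order G 3"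
    by (rule fails_acyclic_matching_at_order_3[OF x(1)])
  moreover have "(3::enat) \<ge> 1"
    by (simp add: numeral_eq_enat one_enat_def)
  ultimately show ?thesis by blast
qed

end
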